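(* Let $\lambda\in\mathfrak h^*_\mathbb{C}$ with $\operatorname{Re}(\lambda)\in\mathcal C^*$. Then for any $M>0$ the series $\sum_{w\in W}M^{\ell(w)}a^{w\lambda}$ converges absolutely and uniformly for $a$ in any fixed compact subset of $A_{\mathfrak C}$.
   Context: $A=(a_{ij})_{i,j\in I}$ is a nonsingular symmetrizable generalized Cartan matrix with real realization $\mathfrak h$, simple roots $\alpha_i\in\mathfrak h^*$, simple coroots $\alpha_i^\vee\in\mathfrak h$, $\langle\alpha_j,\alpha_i^\vee\rangle=a_{ij}$; $W$ the Weyl group with length function $\ell$. $\mathcal C^*=\{\lambda\in\mathfrak h^*:\langle\lambda,\alpha_i^\vee\rangle>0\ \forall i\}$; $\mathcal C=\{x\in\mathfrak h:\langle\alpha_i,x\rangle>0\ \forall i\}$; $\mathfrak C$ is the interior of the Tits cone $\bigcup_{w\in W}w\overline{\mathcal C}$; $A_{\mathfrak C}=\exp(\mathfrak C)$ inside the group $A^+=\exp(\mathfrak h)$, and for $a=\exp(H)$, $a^\mu=e^{\langle\mu,H\rangle}$. *)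

theory Defs
  imports "HOL-Analysis.Analysis" "HOL-Algebra.Bij" "HOL-Algebra.Generated_Groups"
begin

definition generalized_cartan_matrix :: "int^'i^'i::finite \<Rightarrow> bool" where
  "generalized_cartan_matrix A \<longleftrightarrow>
     (\<forall>i. A $ i $ i = 2) \<and>
     (\<forall>i j. i \<noteq> j \<longrightarrow> A $ i $ j \<le> 0) \<and>
     (\<forall>i j. A $ i $ j = 0 \<longleftrightarrow> A $ j $ i = 0)"

definition symmetrizable :: "int^'i^'i::finite \<Rightarrow> bool" where
  "symmetrizable A \<longleftrightarrow>
     (\<exists>D B :: real^'i^'i. (\<forall>i j. i \<noteq> j \<longrightarrow> D $ i $ j = 0) \<and> invertible D \<and>
        transpose B = B \<and> map_matrix real_of_int A = D ** B)"

text \<open>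
  The real vector space \<open>\<hh>\<close> is a type \<^typ>\<open>'h::euclidean_space\<close>, of which only the vector space
  structure and the topology are used. Its dual \<open>\<hh>\<^sup>*\<close> is \<^typ>\<open>'h \<Rightarrow>\<^sub>L real\<close> and the complexified dual
  is \<^typ>\<open>'h \<Rightarrow>\<^sub>L complex\<close>; in finite dimension these contain all real-linear maps.
  For nonsingular \<^term>\<open>A\<close> the dimension condition below says \<open>dim \<hh> = |I|\<close>.
\<close>

definition realization ::
  "int^'i^'i::finite \<Rightarrow> ('i \<Rightarrow> 'h::euclidean_space \<Rightarrow>\<^sub>L real) \<Rightarrow> ('i \<Rightarrow> 'h) \<Rightarrow> bool" where
  "realization A \<alpha> \<alpha>c \<longleftrightarrow>
     inj \<alpha> \<and> independent (range \<alpha>) \<and>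
     inj \<alpha>c \<and> independent (range \<alpha>c) \<and>
     (\<forall>i j. blinfun_apply (\<alpha> j) (\<alpha>c i) = real_of_int (A $ i $ j)) \<and>
     DIM('h) + rank (map_matrix real_of_int A) = 2 * CARD('i)"

definition simple_reflection ::
  "('i \<Rightarrow> 'h::euclidean_space \<Rightarrow>\<^sub>L real) \<Rightarrow> ('i \<Rightarrow> 'h) \<Rightarrow> 'i \<Rightarrow> 'h \<Rightarrow> 'h" where
  "simple_reflection \<alpha> \<alpha>c i x = x - blinfun_apply (\<alpha> i) x *\<^sub>R \<alpha>c i"

definition weyl_group ::
  "('i \<Rightarrow> 'h::euclidean_space \<Rightarrow>\<^sub>L real) \<Rightarrow> ('i \<Rightarrow> 'h) \<Rightarrow> ('h \<Rightarrow> 'h) set" where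
  "weyl_group \<alpha> \<alpha>c = generate (BijGroup UNIV) (range (simple_reflection \<alpha> \<alpha>c))"

definition weyl_length ::
  "('i \<Rightarrow> 'h::euclidean_space \<Rightarrow>\<^sub>L real) \<Rightarrow> ('i \<Rightarrow> 'h) \<Rightarrow> ('h \<Rightarrow> 'h) \<Rightarrow> nat" where
  "weyl_length \<alpha> \<alpha>c w =
     (LEAST n. \<exists>is. length is = n \<and> w = foldr (\<circ>) (map (simple_reflection \<alpha> \<alpha>c) is) id)"

text \<open>
  The contragredient action \<open>\<langle>w\<mu>, x\<rangle> = \<langle>\<mu>, w\<^sup>-\<^sup>1x\<rangle>\<close>; on simple reflections it is
  \<open>\<mu> \<mapsto> \<mu> - \<langle>\<mu>, \<alpha>\<^sub>i\<^sup>\<or>\<rangle>\<alpha>\<^sub>i\<close>, see \<open>dual_action_simple_reflection\<close>.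
\<close>

definition dual_action ::
  "('h \<Rightarrow> 'h) \<Rightarrow> ('h::euclidean_space \<Rightarrow>\<^sub>L 'c::real_normed_vector) \<Rightarrow> 'h \<Rightarrow>\<^sub>L 'c" where
  "dual_action w \<mu> = Blinfun (\<lambda>x. blinfun_apply \<mu> (inv_into UNIV w x))"

definition Re_dual :: "('h::euclidean_space \<Rightarrow>\<^sub>L complex) \<Rightarrow> 'h \<Rightarrow>\<^sub>L real" where
  "Re_dual \<mu> = Blinfun Re o\<^sub>L \<mu>"

definition dual_chamber :: "('i \<Rightarrow> 'h::euclidean_space) \<Rightarrow> ('h \<Rightarrow>\<^sub>L real) set" where
  "dual_chamber \<alpha>c = {\<mu>. \<forall>i. blinfun_apply \<mu> (\<alpha>c i) > 0}"

definition fundamental_chamber :: "('i \<Rightarrow> 'h::euclidean_space \<Rightarrow>\<^sub>L real) \<Rightarrow> 'h set" where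
  "fundamental_chamber \<alpha> = {x. \<forall>i. blinfun_apply (\<alpha> i) x > 0}"

definition tits_cone ::
  "('i \<Rightarrow> 'h::euclidean_space \<Rightarrow>\<^sub>L real) \<Rightarrow> ('i \<Rightarrow> 'h) \<Rightarrow> 'h set" where
  "tits_cone \<alpha> \<alpha>c = (\<Union>w\<in>weyl_group \<alpha> \<alpha>c. w ` closure (fundamental_chamber \<alpha>))"

text \<open>
  The group \<open>A\<^sup>+ = exp(\<hh>)\<close>, with \<open>exp\<close> an isomorphism of topological groups
  from the additive group of \<open>\<hh>\<close>.
\<close>

definition exp_group ::
  "('h::euclidean_space \<Rightarrow> 'g::topological_space) \<Rightarrow> ('g, 'b) monoid_scheme \<Rightarrow> bool" where
  "exp_group ex Ap \<longleftrightarrow>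
     comm_group Ap \<and>
     (\<forall>x y. ex (x + y) = ex x \<otimes>\<^bsub>Ap\<^esub> ex y) \<and>
     homeomorphism UNIV (carrier Ap) ex (inv_into UNIV ex)"

definition torus_power ::
  "('h::euclidean_space \<Rightarrow> 'g) \<Rightarrow> 'g \<Rightarrow> ('h \<Rightarrow>\<^sub>L complex) \<Rightarrow> complex" where
  "torus_power ex a \<mu> = exp (blinfun_apply \<mu> (inv_into UNIV ex a))"

definition weyl_series_term ::
  "('i \<Rightarrow> 'h::euclidean_space \<Rightarrow>\<^sub>L real) \<Rightarrow> ('i \<Rightarrow> 'h) \<Rightarrow> ('h \<Rightarrow> 'g) \<Rightarrow> ('h \<Rightarrow>\<^sub>L complex) \<Rightarrow> real
     \<Rightarrow> ('h \<Rightarrow> 'h) \<Rightarrow> 'g \<Rightarrow> complex" where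
  "weyl_series_term \<alpha> \<alpha>c ex \<mu> M w a =
     complex_of_real M ^ weyl_length \<alpha> \<alpha>c w * torus_power ex a (dual_action w \<mu>)"

lemma torus_power_exp:
  assumes "exp_group ex Ap"
  shows "torus_power ex (ex H) \<mu> = exp (blinfun_apply \<mu> H)"
  using assms by (simp add: torus_power_def exp_group_def homeomorphism_def)

lemma Re_dual_apply: "blinfun_apply (Re_dual \<mu>) x = Re (blinfun_apply \<mu> x)"
  by (simp add: Re_dual_def bounded_linear_Blinfun_apply bounded_linear_Re)

lemma simple_reflection_involution:
  assumes "generalized_cartan_matrix A" "realization A \<alpha> \<alpha>c"
  shows "simple_reflection \<alpha> \<alpha>c i (simple_reflection \<alpha> \<alpha>c i x) = x"
  using assms
  by (simp add: generalized_cartan_matrix_def realization_def simple_reflection_def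
      blinfun.diff_right blinfun.scaleR_right)

lemma dual_action_simple_reflection:
  fixes \<mu> :: "'h::euclidean_space \<Rightarrow>\<^sub>L 'c::real_normed_vector"
  assumes "generalized_cartan_matrix A" "realization A \<alpha> \<alpha>c"
  shows "blinfun_apply (dual_action (simple_reflection \<alpha> \<alpha>c i) \<mu>) x =
         blinfun_apply \<mu> x - blinfun_apply (\<alpha> i) x *\<^sub>R blinfun_apply \<mu> (\<alpha>c i)"
proof -
  let ?s = "simple_reflection \<alpha> \<alpha>c i"
  have "inv_into UNIV ?s = ?s"
    using simple_reflection_involution[OF assms] by (intro inv_equality) auto
  moreover have "bounded_linear (\<lambda>x. blinfun_apply \<mu> (?s x))"
    unfolding simple_reflection_def by (intro bounded_linear_intros)
  ultimately have "blinfun_apply (dual_action ?s \<mu>) x = blinfun_apply \<mu> (?s x)"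
    by (simp add: dual_action_def bounded_linear_Blinfun_apply)
  thus ?thesis
    by (simp add: simple_reflection_def blinfun.diff_right blinfun.scaleR_right)
qed

lemma weyl_group_bij_linear:
  assumes "generalized_cartan_matrix A" "realization A \<alpha> \<alpha>c" "w \<in> weyl_group \<alpha> \<alpha>c"
  shows "bij w \<and> linear w"
proof -
  have s: "bij (simple_reflection \<alpha> \<alpha>c i) \<and> linear (simple_reflection \<alpha> \<alpha>c i)" for i
  proof
    show "bij (simple_reflection \<alpha> \<alpha>c i)"
      using simple_reflection_involution[OF assms(1,2)]
      by (intro involuntory_imp_bij) auto
    show "linear (simple_reflection \<alpha> \<alpha>c i)"
      by (rule linearI)
        (auto simp: simple_reflection_def blinfun.add_right blinfun.scaleR_right algebra_simps)
  qed
  have B: "f \<in> Bij UNIV \<longleftrightarrow> bij f" for f :: "'b \<Rightarrow> 'b"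
    by (auto simp: Bij_def)
  show ?thesis
    using assms(3) unfolding weyl_group_def
  proof (induction rule: generate.induct)
    case one
    show ?case by (simp add: BijGroup_def restrict_def linear_id[unfolded id_def] bij_id[unfolded id_def])
  next
    case (incl h)
    thus ?case using s by auto
  next
    case (inv h)
    then obtain i where h: "h = simple_reflection \<alpha> \<alpha>c i" by auto
    have "bij h" using s h by auto
    hence "m_inv (BijGroup UNIV) h = inv_into UNIV h"
      by (subst inv_BijGroup) (auto simp: B restrict_def)
    also have "\<dots> = h"
      unfolding h using simple_reflection_involution[OF assms(1,2)] by (intro inv_equality) auto
    finally show ?case using s h by auto
  next
    case (eng h1 h2)
    have "h1 \<otimes>\<^bsub>BijGroup UNIV\<^esub> h2 = h1 \<circ> h2"
      using eng.IH by (auto simp: BijGroup_def B compose_def fun_eq_iff)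
    thus ?case using eng.IH by (metis bij_comp linear_compose)
  qed
qed

lemma dual_action_apply:
  assumes "generalized_cartan_matrix A" "realization A \<alpha> \<alpha>c" "w \<in> weyl_group \<alpha> \<alpha>c"
  shows "blinfun_apply (dual_action w \<mu>) x = blinfun_apply \<mu> (inv_into UNIV w x)"
proof -
  have w: "bij w" "linear w" using weyl_group_bij_linear[OF assms] by auto
  hence "linear (inv_into UNIV w)"
    by (metis bij_is_inj bij_is_surj linear_injective_left_inverse left_right_inverse_eq surj_iff
        inj_iff)
  hence "bounded_linear (\<lambda>x. blinfun_apply \<mu> (inv_into UNIV w x))"
    by (intro bounded_linear_compose[OF blinfun.bounded_linear_right] linear_conv_bounded_linear[THEN iffD1])
  thus ?thesis by (simp add: dual_action_def bounded_linear_Blinfun_apply)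
qed

end

theory Submission
  imports Defs
begin

text \<open>
  Put \<open>\<rho> = Re \<lambda>\<close>, so that the modulus of the term at \<open>exp x\<close> is \<open>M\<^bsup>\<ell>(w)\<^esup> e\<^bsup>\<rho>(w\<inverse>x)\<^esup>\<close>. There are at most
  \<open>|I|\<^sup>n\<close> elements of length \<open>n\<close>, so it suffices that for every \<open>r\<close> there is \<open>C\<close> with
  \<open>\<rho>(w\<inverse>x) \<le> C - r \<ell>(w)\<close> for all \<open>w\<close>, uniformly on compact sets. For \<open>x\<close> in the open fundamental
  chamber, \<open>\<rho>(x) - \<rho>(w\<inverse>x)\<close> is a combination, with coefficients bounded below, of the values at
  \<open>x\<close> of the \<open>\<ell>(w)\<close> distinct inversion roots of \<open>w\<close>; as only finitely many positive roots have
  bounded height, this grows superlinearly in \<open>\<ell>(w)\<close>. The set of all \<open>x\<close> with such estimates is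
  convex and \<open>W\<close>-invariant, so it contains the interior of the Tits cone, because a convex set
  and its closure have the same interior. The same convexity makes the estimates uniform on
  polytopes, hence on compact sets.
\<close>

section \<open>Dihedral words and coefficients\<close>

text \<open>The first letter is the second argument, so that \<open>s # alternating s t k\<close> is
  again alternating, namely \<open>alternating t s (Suc k)\<close>.\<close>

fun alternating :: "'a \<Rightarrow> 'a \<Rightarrow> nat \<Rightarrow> 'a list" where
  "alternating s t 0 = []"
| "alternating s t (Suc n) = t # alternating t s n"

lemma length_alternating [simp]: "length (alternating s t n) = n"
  by (induction n arbitrary: s t) auto

lemma alternating_Suc_append:
  "alternating s t (Suc n) = alternating s t n @ [if even n then t else s]"
  by (induction n arbitrary: s t) auto

lemma alternating_split:
  assumes "m \<le> n"
  shows "\<exists>zs. alternating s t n = alternating s t m @ zs"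
  using assms
proof (induction n rule: dec_induct)
  case (step n)
  then show ?case using alternating_Suc_append[of s t n] by auto
qed simp

text \<open>
  With \<open>a = -a\<^sub>t\<^sub>s\<close> and \<open>b = -a\<^sub>s\<^sub>t\<close>, these are the coordinates with respect to \<open>\<alpha>\<^sub>s, \<alpha>\<^sub>t\<close> of \<open>\<alpha>\<^sub>s\<close>
  composed with an alternating word of length \<open>k\<close> whose outermost letter is \<open>t\<close>.
\<close>

fun dihedral_coeffs :: "int \<Rightarrow> int \<Rightarrow> nat \<Rightarrow> int \<times> int" where
  "dihedral_coeffs a b 0 = (1, 0)"
| "dihedral_coeffs a b (Suc 0) = (1, a)"
| "dihedral_coeffs a b (Suc (Suc k)) =
     (a * snd (dihedral_coeffs b a (Suc k)) - fst (dihedral_coeffs a b k),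
      a * fst (dihedral_coeffs b a (Suc k)) - snd (dihedral_coeffs a b k))"

text \<open>One step of the recursion of \<open>dihedral_coeffs\<close>: the bound
  \<open>b * x \<ge> 2 * y\<close> passes on to the new coefficient \<open>b * x - y\<close>,
  because twice the left side is \<open>a * b * x + a * (b * x - 2 * y)\<close>.\<close>

lemma doubling_step:
  fixes a b x y :: int
  assumes "a \<ge> 0" "a * b \<ge> 4" "x \<ge> 0" "b * x \<ge> 2 * y"
  shows "a * (b * x - y) \<ge> 2 * x"
proof -
  have "2 * (a * (b * x - y)) = a * b * x + a * (b * x - 2 * y)"
    by (simp add: algebra_simps)
  moreover have "a * (b * x - 2 * y) \<ge> 0" using assms by simp
  moreover have "a * b * x \<ge> 4 * x" using assms by (intro mult_right_mono) auto
  ultimately show ?thesis by linarith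
qed

text \<open>The last two inequalities carry the induction: the term subtracted in the recursion is
  at most half of the other one, so no coefficient turns negative. Each step swaps \<open>a\<close>
  and \<open>b\<close>, hence the induction treats both orders at once.\<close>

lemma dihedral_coeffs_growth:
  assumes "a \<ge> 0" "b \<ge> 0" "a * b \<ge> 4"
  shows "fst (dihedral_coeffs a b k) \<ge> 0 \<and> snd (dihedral_coeffs a b k) \<ge> 0 \<and>
         a * snd (dihedral_coeffs b a (Suc k)) \<ge> 2 * fst (dihedral_coeffs a b k) \<and>
         a * fst (dihedral_coeffs b a (Suc k)) \<ge> 2 * snd (dihedral_coeffs a b k)"
  using assms
proof (induction k arbitrary: a b)
  case 0
  then show ?case by auto
next
  case (Suc k)
  have ba: "b * a \<ge> 4" using Suc.prems by (simp add: mult.commute)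
  note IH1 = Suc.IH[OF Suc.prems] and IH2 = Suc.IH[OF Suc.prems(2,1) ba]
  have nonneg: "fst (dihedral_coeffs a b (Suc k)) \<ge> 0" "snd (dihedral_coeffs a b (Suc k)) \<ge> 0"
  proof -
    have "b * snd (dihedral_coeffs a b (Suc k)) \<ge> 0" "b * fst (dihedral_coeffs a b (Suc k)) \<ge> 0"
      using IH2 by linarith+
    moreover have "b > 0" using Suc.prems by (cases "b = 0") auto
    ultimately show "fst (dihedral_coeffs a b (Suc k)) \<ge> 0" "snd (dihedral_coeffs a b (Suc k)) \<ge> 0"
      by (simp_all add: zero_le_mult_iff)
  qed
  show ?case
    using nonneg IH2 doubling_step[OF Suc.prems(1,3)] by simp
qed

text \<open>These are the off-diagonal entries, up to sign, of the rank two types A1 x A1, A2, B2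
  and G2.\<close>

lemma small_product_cases:
  fixes a b :: int
  assumes "a \<ge> 0" "b \<ge> 0" "a * b < 4" "a = 0 \<longleftrightarrow> b = 0"
  shows "(a, b) \<in> {(0,0), (1,1), (1,2), (2,1), (1,3), (3,1)}"
proof (cases "a = 0")
  case False
  with assms have ab: "a \<ge> 1" "b \<ge> 1" by auto
  have "a < 4" using mult_left_mono[of 1 b a] ab assms by linarith
  moreover have "b < 4" using mult_right_mono[of 1 a b] ab assms by linarith
  ultimately have "a \<in> {1,2,3}" "b \<in> {1,2,3}" using ab by auto
  then show ?thesis using assms(3) by auto
qed (use assms in auto)

text \<open>By injectivity at most \<open>card {d. sum d UNIV \<le> N}\<close> of the vectors have
  small total; each of the remaining ones contributes at least \<open>N\<close>. The difference is
  taken in the reals and may be negative.\<close>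

lemma sum_weights_ge:
  fixes c :: "nat \<Rightarrow> 'i::finite \<Rightarrow> nat"
  assumes "inj_on c {..<n}"
  shows "real N * (real n - real (card {d :: 'i \<Rightarrow> nat. sum d UNIV \<le> N}))
           \<le> real (\<Sum>k<n. sum (c k) UNIV)"
proof -
  let ?S = "{d :: 'i \<Rightarrow> nat. sum d UNIV \<le> N}"
  let ?L = "{k\<in>{..<n}. sum (c k) UNIV \<le> N}"
  have "?S \<subseteq> PiE UNIV (\<lambda>_. {..N})"
    by (auto simp: PiE_def) (meson UNIV_I finite member_le_sum order_trans zero_le)
  then have "finite ?S" by (rule finite_subset) (simp add: finite_PiE)
  then have "card ?L \<le> card ?S"
    by (intro card_inj_on_le[of c]) (use assms in \<open>auto simp: inj_on_def\<close>)
  moreover have "card ({..<n} - ?L) = n - card ?L" by (subst card_Diff_subset) auto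
  moreover have "card ?L \<le> n" using card_mono[of "{..<n}" ?L] by (simp add: subset_eq)
  ultimately have "real n - real (card ?S) \<le> real (card ({..<n} - ?L))" by simp
  then have "real N * (real n - real (card ?S)) \<le> real N * real (card ({..<n} - ?L))"
    by (intro mult_left_mono) auto
  also have "\<dots> = real (\<Sum>k\<in>{..<n} - ?L. N)" by simp
  also have "(\<Sum>k\<in>{..<n} - ?L. N) \<le> (\<Sum>k\<in>{..<n} - ?L. sum (c k) UNIV)"
    by (rule sum_mono) auto
  also have "\<dots> \<le> (\<Sum>k<n. sum (c k) UNIV)"
    by (rule sum_mono2) auto
  finally show ?thesis by simp
qed

section \<open>Positivity of real roots\<close>

locale cartan_pairing =
  fixes A :: "int^'i^'i::finite"
    and \<alpha> :: "'i \<Rightarrow> 'h::euclidean_space \<Rightarrow>\<^sub>L real"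
    and \<alpha>c :: "'i \<Rightarrow> 'h"
  assumes gcm: "generalized_cartan_matrix A"
    and pairing: "blinfun_apply (\<alpha> j) (\<alpha>c i) = real_of_int (A $ i $ j)"
begin

section \<open>Words in the simple reflections and the length function\<close>

abbreviation srefl :: "'i \<Rightarrow> 'h \<Rightarrow> 'h" where
  "srefl \<equiv> simple_reflection \<alpha> \<alpha>c"

definition act :: "'i list \<Rightarrow> 'h \<Rightarrow> 'h" where
  "act js = foldr (\<circ>) (map srefl js) id"

abbreviation len :: "('h \<Rightarrow> 'h) \<Rightarrow> nat" where
  "len \<equiv> weyl_length \<alpha> \<alpha>c"

lemma cartan_diag: "A $ i $ i = 2"
  and cartan_off_diag: "i \<noteq> j \<Longrightarrow> A $ i $ j \<le> 0"
  and cartan_zero_iff: "A $ i $ j = 0 \<longleftrightarrow> A $ j $ i = 0"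
  using gcm by (auto simp: generalized_cartan_matrix_def)

lemma act_Nil [simp]: "act [] = id"
  and act_Cons [simp]: "act (j # js) = srefl j \<circ> act js"
  by (simp_all add: act_def)

lemma act_append [simp]: "act (js @ ks) = act js \<circ> act ks"
  by (induction js) (auto simp: fun_eq_iff)

lemma root_srefl: "\<alpha> j (srefl i x) = \<alpha> j x - real_of_int (A $ i $ j) * \<alpha> i x"
  by (simp add: simple_reflection_def blinfun.diff_right blinfun.scaleR_right pairing)

lemma srefl_srefl [simp]: "srefl i (srefl i x) = x"
  by (simp add: simple_reflection_def blinfun.diff_right blinfun.scaleR_right pairing cartan_diag)

lemma act_rev_cancel [simp]: "act js (act (rev js) x) = x" "act (rev js) (act js x) = x"
  by (induction js arbitrary: x) auto

lemma linear_srefl: "linear (srefl i)"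
  by (rule linearI)
    (auto simp: simple_reflection_def blinfun.add_right blinfun.scaleR_right algebra_simps)

lemma linear_act: "linear (act js)"
proof (induction js)
  case (Cons j js)
  then show ?case unfolding act_Cons by (rule linear_compose[OF _ linear_srefl])
qed (simp add: linear_id[unfolded id_def] id_def)

lemma inv_act: "inv_into UNIV (act js) = act (rev js)"
  by (rule inv_equality) auto

text \<open>Simple reflections are involutions, so inverses of generators are again letters.\<close>

lemma weyl_group_subset: "weyl_group \<alpha> \<alpha>c \<subseteq> range act"
proof
  fix w assume "w \<in> weyl_group \<alpha> \<alpha>c"
  then show "w \<in> range act"
    unfolding weyl_group_def
  proof (induction rule: generate.induct)
    case one
    have "\<one>\<^bsub>BijGroup UNIV\<^esub> = act []" by (simp add: BijGroup_def restrict_def id_def)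
    then show ?case by blast
  next
    case (incl h)
    then obtain i where "h = act [i]" by auto
    then show ?case by blast
  next
    case (inv h)
    then obtain i where h: "h = act [i]" by auto
    have "bij h" by (rule o_bij[of h]) (auto simp: h)
    then have "m_inv (BijGroup UNIV) h = inv_into UNIV h"
      by (subst inv_BijGroup) (auto simp: Bij_def restrict_def)
    then have "m_inv (BijGroup UNIV) h = act [i]" by (metis h inv_act rev_singleton_conv)
    then show ?case by blast
  next
    case (eng h1 h2)
    then obtain js ks where h: "h1 = act js" "h2 = act ks" by auto
    have bij: "bij (act us)" for us
      by (rule o_bij[of "act (rev us)"]) (auto simp: fun_eq_iff)
    have "h1 \<otimes>\<^bsub>BijGroup UNIV\<^esub> h2 = act (js @ ks)"
      using bij[of js] bij[of ks] by (auto simp: h BijGroup_def Bij_def compose_def fun_eq_iff)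
    then show ?case by blast
  qed
qed

lemma len_act_le: "len (act js) \<le> length js"
  unfolding weyl_length_def act_def by (rule Least_le) blast

lemma reduced_word:
  obtains ks where "act ks = act js" "length ks = len (act js)"
proof -
  have "\<exists>ks. length ks = len (act js) \<and> act js = foldr (\<circ>) (map srefl ks) id"
    unfolding weyl_length_def act_def by (rule LeastI_ex) blast
  then show ?thesis using that by (auto simp: act_def)
qed

lemma len_act_append_le: "len (act (js @ ks)) \<le> length js + len (act ks)"
proof -
  obtain us where "act us = act ks" "length us = len (act ks)" using reduced_word .
  then show ?thesis using len_act_le[of "js @ us"] by simp
qed

lemma len_act_rev: "len (act (rev js)) = len (act js)"
proof -
  have "len (act (rev js)) \<le> len (act js)" for js
  proof -
    obtain us where us: "act us = act js" "length us = len (act js)" using reduced_word .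
    then have "act (rev us) = act (rev js)" by (metis inv_act)
    then show ?thesis using us len_act_le[of "rev us"] by simp
  qed
  from this[of js] this[of "rev js"] show ?thesis by simp
qed

definition reduced :: "'i list \<Rightarrow> bool" where
  "reduced js \<longleftrightarrow> len (act js) = length js"

text \<open>A shorter word for either factor would shorten the whole word.\<close>

lemma reduced_append:
  assumes "reduced (js @ ks)"
  shows "reduced js" "reduced ks"
proof -
  show "reduced ks"
    using assms len_act_append_le[of js ks] len_act_le[of ks] by (simp add: reduced_def)
  obtain us where us: "act us = act js" "length us = len (act js)" using reduced_word .
  have "len (act (us @ ks)) = len (act (js @ ks))" using us by simp
  then show "reduced js"
    using assms us len_act_le[of "us @ ks"] len_act_le[of js] by (simp add: reduced_def)
qed

section \<open>Nonnegative combinations of simple roots, and rank two relations\<close>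

text \<open>Membership in the monoid spanned by the simple roots: \<open>f\<close> need not be a
  root and may be zero. Plain functions are used since the roots arise as compositions of some
  \<open>\<alpha> i\<close> with \<open>act js\<close>.\<close>

definition positive_root :: "('h \<Rightarrow> real) \<Rightarrow> bool" where
  "positive_root f \<longleftrightarrow> (\<exists>c :: 'i \<Rightarrow> nat. \<forall>x. f x = (\<Sum>i\<in>UNIV. real (c i) * \<alpha> i x))"

lemma positive_root_simple: "positive_root (\<alpha> i)"
  unfolding positive_root_def
  by (rule exI[of _ "\<lambda>j. if j = i then 1 else 0"]) (simp add: if_distrib if_distribR cong: if_cong)

lemma positive_root_combination:
  assumes "positive_root f" "positive_root g" "p \<ge> 0" "q \<ge> 0"
  shows "positive_root (\<lambda>x. real_of_int p * f x + real_of_int q * g x)"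
proof -
  obtain c d :: "'i \<Rightarrow> nat" where
    "f x = (\<Sum>i\<in>UNIV. real (c i) * \<alpha> i x)" "g x = (\<Sum>i\<in>UNIV. real (d i) * \<alpha> i x)" for x
    using assms unfolding positive_root_def by blast
  then show ?thesis
    unfolding positive_root_def using assms(3,4)
    by (intro exI[of _ "\<lambda>i. nat p * c i + nat q * d i"])
      (simp add: sum_distrib_left sum.distrib algebra_simps)
qed

lemma dihedral_root:
  "\<alpha> s (act (alternating s t k) x) =
     real_of_int (fst (dihedral_coeffs (- (A $ t $ s)) (- (A $ s $ t)) k)) * \<alpha> s x +
     real_of_int (snd (dihedral_coeffs (- (A $ t $ s)) (- (A $ s $ t)) k)) * \<alpha> t x"
proof (induction k arbitrary: s t x rule: less_induct)
  case (less k)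
  consider "k = 0" | "k = 1" | j where "k = Suc (Suc j)"
    by (metis One_nat_def not0_implies_Suc)
  then show ?case
  proof cases
    case 3
    \<comment> \<open>Removing the outer \<open>t\<close> leaves a word that starts with
      \<open>s\<close>, under which \<open>\<alpha> s\<close> changes sign. Both resulting terms
      fall under the induction hypothesis, the first with \<open>s\<close> and \<open>t\<close>
      exchanged.\<close>
    have "\<alpha> s (act (alternating s t k) x) =
        - real_of_int (A $ t $ s) * \<alpha> t (act (alternating t s (Suc j)) x)
        - \<alpha> s (act (alternating s t j) x)"
      by (simp add: 3 root_srefl cartan_diag algebra_simps)
    also have "\<dots> = - real_of_int (A $ t $ s) *
          (real_of_int (fst (dihedral_coeffs (- (A $ s $ t)) (- (A $ t $ s)) (Suc j))) * \<alpha> t x +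
           real_of_int (snd (dihedral_coeffs (- (A $ s $ t)) (- (A $ t $ s)) (Suc j))) * \<alpha> s x)
        - (real_of_int (fst (dihedral_coeffs (- (A $ t $ s)) (- (A $ s $ t)) j)) * \<alpha> s x +
           real_of_int (snd (dihedral_coeffs (- (A $ t $ s)) (- (A $ s $ t)) j)) * \<alpha> t x)"
      using less[of "Suc j" t s x] less[of j s t x] 3 by simp
    finally show ?thesis by (simp add: 3 algebra_simps)
  qed (simp_all add: root_srefl)
qed

text \<open>For the products 0, 1, 2, 3 the relation holds with \<open>m\<close> equal to 2, 3, 4,
  6, and the finitely many coefficients below \<open>m\<close> are computed.\<close>

lemma braid_relation:
  assumes "s \<noteq> t" and "A $ s $ t * A $ t $ s < 4"
  shows "\<exists>m>0. act (alternating s t m) = act (alternating t s m) \<and>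
           (\<forall>k<m. fst (dihedral_coeffs (- (A $ t $ s)) (- (A $ s $ t)) k) \<ge> 0 \<and>
                  snd (dihedral_coeffs (- (A $ t $ s)) (- (A $ s $ t)) k) \<ge> 0)"
proof -
  have small: "(- (A $ t $ s), - (A $ s $ t)) \<in> {(0,0), (1,1), (1,2), (2,1), (1,3), (3,1)}"
    using assms cartan_off_diag[of s t] cartan_off_diag[of t s] cartan_zero_iff[of s t]
    by (intro small_product_cases) (auto simp: mult.commute)
  \<comment> \<open>Words in \<open>s\<close> and \<open>t\<close> change \<open>x\<close> only by
    multiples of the two coroots. Recording these multiples reduces the comparison of two words to
    scalar arithmetic.\<close>
  define nf where "nf x p q = x - p *\<^sub>R \<alpha>c s - q *\<^sub>R \<alpha>c t" for x and p q :: real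
  have step: "srefl s (nf x p q) = nf x (\<alpha> s x - p - real_of_int (A $ t $ s) * q) q"
    "srefl t (nf x p q) = nf x p (\<alpha> t x - q - real_of_int (A $ s $ t) * p)" for x p q
    by (simp_all add: nf_def simple_reflection_def blinfun.diff_right blinfun.add_right
        blinfun.scaleR_right pairing cartan_diag algebra_simps)
      (simp_all flip: scaleR_add_left)
  have act_eqI: "act js = act ks" if "\<And>x. act js (nf x 0 0) = act ks (nf x 0 0)" for js ks
    using that by (simp add: nf_def fun_eq_iff)
  consider "A $ t $ s = 0" "A $ s $ t = 0" | "A $ t $ s = -1" "A $ s $ t = -1"
    | "A $ t $ s = -1" "A $ s $ t = -2" | "A $ t $ s = -2" "A $ s $ t = -1"
    | "A $ t $ s = -1" "A $ s $ t = -3" | "A $ t $ s = -3" "A $ s $ t = -1"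
    using small by auto
  then show ?thesis
  proof cases
    case 1
    have "act (alternating s t 2) = act (alternating t s 2)"
      by (rule act_eqI) (simp add: 1 step eval_nat_numeral add_ac)
    then show ?thesis
      by (intro exI[of _ 2]) (simp add: 1 eval_nat_numeral All_less_Suc)
  next
    case 2
    have "act (alternating s t 3) = act (alternating t s 3)"
      by (rule act_eqI) (simp add: 2 step eval_nat_numeral add_ac)
    then show ?thesis
      by (intro exI[of _ 3]) (simp add: 2 eval_nat_numeral All_less_Suc)
  next
    case 3
    have "act (alternating s t 4) = act (alternating t s 4)"
      by (rule act_eqI) (simp add: 3 step eval_nat_numeral add_ac)
    then show ?thesis
      by (intro exI[of _ 4]) (simp add: 3 eval_nat_numeral All_less_Suc)
  next
    case 4
    have "act (alternating s t 4) = act (alternating t s 4)"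
      by (rule act_eqI) (simp add: 4 step eval_nat_numeral add_ac)
    then show ?thesis
      by (intro exI[of _ 4]) (simp add: 4 eval_nat_numeral All_less_Suc)
  next
    case 5
    have "act (alternating s t 6) = act (alternating t s 6)"
      by (rule act_eqI) (simp add: 5 step eval_nat_numeral add_ac)
    then show ?thesis
      by (intro exI[of _ 6]) (simp add: 5 eval_nat_numeral All_less_Suc)
  next
    case 6
    have "act (alternating s t 6) = act (alternating t s 6)"
      by (rule act_eqI) (simp add: 6 step eval_nat_numeral add_ac)
    then show ?thesis
      by (intro exI[of _ 6]) (simp add: 6 eval_nat_numeral All_less_Suc)
  qed
qed

text \<open>
  As in Humphreys, \<^emph>\<open>Reflection Groups and Coxeter Groups\<close>, 5.4: split off the longest
  alternating prefix of a reduced word of \<open>g\<close>; what remains is a shorter element to which the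
  induction hypothesis applies for both letters of the prefix.
\<close>

lemma positive_root_act:
  assumes "len (act js) \<le> len (srefl i \<circ> act js)"
  shows "positive_root (\<lambda>x. \<alpha> i (act js x))"
  using assms
proof (induction "len (act js)" arbitrary: js i rule: less_induct)
  case less
  let ?g = "act js"
  obtain ks where ks: "act ks = ?g" "length ks = len ?g" using reduced_word .
  show ?case
  proof (cases ks)
    case Nil
    then show ?thesis using ks positive_root_simple[of i] by (simp flip: ks)
  next
    case (Cons t ks')
    have "t \<noteq> i"
    proof
      assume "t = i"
      then have "srefl i \<circ> ?g = act ks'" using ks Cons by (auto simp: fun_eq_iff simp flip: ks)
      then show False using less.prems len_act_le[of ks'] ks Cons by simp
    qed
    \<comment> \<open>\<open>Q k\<close> says that some reduced word of \<open>act js\<close> begins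
      with an alternating prefix of length \<open>k\<close>. The greatest such \<open>k\<close> is
      used.\<close>
    define Q where "Q k \<longleftrightarrow> (\<exists>vs. ?g = act (alternating i t k @ vs) \<and> k + length vs = len ?g)" for k
    have "Q 1" unfolding Q_def using ks Cons by (intro exI[of _ ks']) auto
    moreover have bound: "\<forall>k. Q k \<longrightarrow> k \<le> len ?g" by (auto simp: Q_def)
    ultimately have "Q (Greatest Q)" and ge1: "1 \<le> Greatest Q"
      by (blast intro: GreatestI_nat Greatest_le_nat)+
    define k where "k = Greatest Q"
    have "\<not> Q (Suc k)" using bound Greatest_le_nat[of Q "Suc k" "len ?g"] by (auto simp: k_def)
    obtain vs where vs: "?g = act (alternating i t k @ vs)" "k + length vs = len ?g"
      using \<open>Q (Greatest Q)\<close> unfolding Q_def k_def by blast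
    have len_vs: "len (act vs) = length vs"
      using len_act_append_le[of "alternating i t k" vs] vs len_act_le[of vs] by simp
    \<comment> \<open>Suppose \<open>p\<close> shortens the remainder. If \<open>p\<close> continues
      the alternation, it can be moved into the prefix, against maximality of \<open>k\<close>;
      otherwise it cancels the last letter of the prefix, and \<open>act js\<close> gets a word
      shorter than its length.\<close>
    have step: "len (act vs) \<le> len (srefl p \<circ> act vs)" if "p \<in> {i, t}" for p
    proof (rule ccontr)
      assume shorter: "\<not> ?thesis"
      obtain us where us: "act us = act (p # vs)" "length us = len (act (p # vs))" using reduced_word .
      have v: "act vs = act (p # us)" using us by (simp add: fun_eq_iff)
      have us_less: "length us < length vs" using us shorter len_vs by simp
      show False
      proof (cases "p = (if even k then t else i)")
        case True
        then have g: "?g = act (alternating i t (Suc k) @ us)"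
          unfolding alternating_Suc_append using vs(1) v by (simp add: o_assoc)
        then have "Suc k + length us \<ge> len ?g"
          using len_act_le[of "alternating i t (Suc k) @ us"] by simp
        then have "Q (Suc k)"
          unfolding Q_def using g us_less vs(2) by (intro exI[of _ us]) auto
        with \<open>\<not> Q (Suc k)\<close> show False by blast
      next
        case False
        obtain l where l: "k = Suc l" using ge1 by (cases k) (auto simp: k_def)
        have "p = (if even l then t else i)" using False that l by (auto split: if_splits)
        then have "alternating i t k = alternating i t l @ [p]"
          unfolding l alternating_Suc_append by simp
        then have "?g = act (alternating i t l @ us)" using vs(1) v by (simp add: fun_eq_iff)
        then show False
          using len_act_le[of "alternating i t l @ us"] us_less vs(2) l by simp
      qed
    qed
    have "len (act vs) < len ?g" using vs(2) len_vs ge1 k_def by simp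
    then have pos: "positive_root (\<lambda>x. \<alpha> i (act vs x))" "positive_root (\<lambda>x. \<alpha> t (act vs x))"
      using less.hyps step by auto
    let ?c = "dihedral_coeffs (- (A $ t $ i)) (- (A $ i $ t)) k"
    have "fst ?c \<ge> 0 \<and> snd ?c \<ge> 0"
    proof (cases "A $ i $ t * A $ t $ i < 4")
      case False
      then show ?thesis
        using dihedral_coeffs_growth[of "- (A $ t $ i)" "- (A $ i $ t)" k]
          cartan_off_diag \<open>t \<noteq> i\<close> by (simp add: mult.commute)
    next
      case True
      then obtain m where m: "m > 0" "act (alternating i t m) = act (alternating t i m)"
        and coeffs: "\<forall>k<m. fst (dihedral_coeffs (- (A $ t $ i)) (- (A $ i $ t)) k) \<ge> 0 \<and>
                  snd (dihedral_coeffs (- (A $ t $ i)) (- (A $ i $ t)) k) \<ge> 0"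
        using braid_relation \<open>t \<noteq> i\<close> by metis
      \<comment> \<open>Otherwise the braid relation turns the prefix into one that starts with
        \<open>i\<close>, and then \<open>srefl i\<close> shortens \<open>act js\<close>, against
        the premise.\<close>
      have "k < m"
      proof (rule ccontr)
        assume "\<not> k < m"
        then obtain zs where zs: "alternating i t k = alternating i t m @ zs"
          using alternating_split[of m k i t] by auto
        obtain l where l: "m = Suc l" using m(1) by (cases m) auto
        have "srefl i \<circ> ?g = act (alternating i t l @ zs @ vs)"
          using vs(1) m(2) by (simp add: zs l fun_eq_iff)
        moreover have "k = m + length zs" using arg_cong[OF zs, of length] by simp
        ultimately show False
          using less.prems len_act_le[of "alternating i t l @ zs @ vs"] vs(2) l by simp
      qed
      with coeffs show ?thesis by blast
    qed
    then show ?thesis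
      using positive_root_combination[OF pos, of "fst ?c" "snd ?c"]
      by (simp add: vs(1) dihedral_root)
  qed
qed

lemma positive_root_reduced:
  assumes "reduced (j # js)"
  shows "positive_root (\<lambda>x. \<alpha> j (act js x))"
proof (rule positive_root_act)
  have "reduced js" using reduced_append(2)[of "[j]" js] assms by simp
  then show "len (act js) \<le> len (srefl j \<circ> act js)"
    using assms by (simp add: reduced_def)
qed

section \<open>Inversion roots of a reduced word\<close>

text \<open>Telescoping: each letter subtracts one term. For a reduced word the functions
  \<open>\<alpha> (js ! k)\<close> composed with \<open>act (drop (Suc k) js)\<close> are the
  inversion roots.\<close>

lemma functional_act_expansion:
  fixes \<rho> :: "'h \<Rightarrow>\<^sub>L real"
  shows "\<rho> (act js x) =
    \<rho> x - (\<Sum>k<length js. \<rho> (\<alpha>c (js ! k)) * \<alpha> (js ! k) (act (drop (Suc k) js) x))"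
proof (induction js)
  case (Cons j js)
  have "\<rho> (act (j # js) x) = \<rho> (act js x) - \<rho> (\<alpha>c j) * \<alpha> j (act js x)"
    by (simp add: simple_reflection_def blinfun.diff_right blinfun.scaleR_right)
  then show ?case using Cons by (simp add: sum.lessThan_Suc_shift del: act_Cons sum.lessThan_Suc)
qed simp

lemma inversion_roots_distinct:
  assumes "reduced js" "k < l" "l < length js" and x: "x \<in> fundamental_chamber \<alpha>"
    and eq: "\<And>y. \<alpha> (js ! k) (act (drop (Suc k) js) y) = \<alpha> (js ! l) (act (drop (Suc l) js) y)"
  shows False
proof -
  define us where "us = take k js"
  define ms where "ms = take (l - Suc k) (drop (Suc k) js)"
  define vs where "vs = drop (Suc l) js"
  have drop_k: "drop (Suc k) js = ms @ js ! l # vs"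
  proof -
    have "drop (Suc k) js = ms @ drop (l - Suc k) (drop (Suc k) js)"
      by (simp add: ms_def del: drop_drop)
    also have "drop (l - Suc k) (drop (Suc k) js) = js ! l # vs"
      using assms by (simp add: vs_def Cons_nth_drop_Suc)
    finally show ?thesis .
  qed
  have "js = us @ js ! k # drop (Suc k) js"
    using assms by (simp add: us_def id_take_nth_drop)
  then have "js = us @ (js ! k # ms) @ (js ! l # vs)" using drop_k by simp
  then have "reduced (js ! k # ms)" using assms(1) reduced_append by metis
  then obtain c :: "'i \<Rightarrow> nat"
    where c: "\<alpha> (js ! k) (act ms y) = (\<Sum>i\<in>UNIV. real (c i) * \<alpha> i y)" for y
    using positive_root_reduced unfolding positive_root_def by metis
  \<comment> \<open>The point inserted for \<open>y\<close> undoes the tail of the word from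
    position \<open>l\<close> on. The left side is then the value of a positive root in the chamber,
    whereas the right side is negative there.\<close>
  have "\<alpha> (js ! k) (act ms x) = - \<alpha> (js ! l) x"
    using eq[of "act (rev vs) (srefl (js ! l) x)"]
    by (simp add: drop_k vs_def[symmetric] root_srefl cartan_diag)
  moreover have "\<alpha> (js ! k) (act ms x) \<ge> 0"
    unfolding c using x by (intro sum_nonneg) (auto simp: fundamental_chamber_def less_imp_le)
  ultimately show False using x by (auto simp: fundamental_chamber_def) (meson not_less)
qed

section \<open>Decay along the Weyl group orbit\<close>

text \<open>Quantifying over words avoids inverses: reversing a word inverts \<open>act\<close> and
  preserves \<open>len\<close>, so the inverse in the dual action is covered.\<close>

definition decay_set :: "('h \<Rightarrow>\<^sub>L real) \<Rightarrow> real \<Rightarrow> real \<Rightarrow> 'h set" where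
  "decay_set \<rho> r C = {x. \<forall>js. \<rho> (act js x) \<le> C - r * real (len (act js))}"

text \<open>Every rate \<open>r\<close> is demanded, since the decay must beat both the powers of
  \<open>M\<close> and the number of words of each length. The constant may depend on the
  point.\<close>

definition decay_domain :: "('h \<Rightarrow>\<^sub>L real) \<Rightarrow> 'h set" where
  "decay_domain \<rho> = {x. \<forall>r\<ge>0. \<exists>C. x \<in> decay_set \<rho> r C}"

lemma decay_set_mono: "C \<le> C' \<Longrightarrow> decay_set \<rho> r C \<subseteq> decay_set \<rho> r C'"
  unfolding decay_set_def by (auto intro: order_trans diff_right_mono)

text \<open>
  The inversion roots of a reduced word are distinct nonnegative integral combinations of simple
  roots, and only finitely many such combinations have height at most \<open>N\<close>; hence their total
  height grows faster than any multiple of the length.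
\<close>

lemma chamber_subset_decay_domain:
  assumes "\<rho> \<in> dual_chamber \<alpha>c"
  shows "fundamental_chamber \<alpha> \<subseteq> decay_domain \<rho>"
proof
  fix x assume x: "x \<in> fundamental_chamber \<alpha>"
  define \<epsilon> where "\<epsilon> = Min (range (\<lambda>i. \<rho> (\<alpha>c i)))"
  define \<delta> where "\<delta> = Min (range (\<lambda>i. \<alpha> i x))"
  have \<epsilon>: "\<epsilon> > 0" "\<And>i. \<epsilon> \<le> \<rho> (\<alpha>c i)"
    using assms by (auto simp: \<epsilon>_def dual_chamber_def)
  have \<delta>: "\<delta> > 0" "\<And>i. \<delta> \<le> \<alpha> i x"
    using x by (auto simp: \<delta>_def fundamental_chamber_def)
  have "\<exists>C. x \<in> decay_set \<rho> r C" if "r \<ge> 0" for r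
  proof -
    \<comment> \<open>An inversion root of height above \<open>N\<close> lowers the value by at
      least \<open>\<epsilon> * \<delta> * N\<close>, which is at least \<open>r\<close>. At most
      \<open>F\<close> inversion roots are lower, and their deficit goes into the constant.\<close>
    obtain N :: nat where "r / (\<epsilon> * \<delta>) \<le> real N" using real_arch_simple by blast
    then have N: "r \<le> \<epsilon> * \<delta> * real N" using \<epsilon> \<delta> by (simp add: field_simps)
    define F where "F = card {d :: 'i \<Rightarrow> nat. sum d UNIV \<le> N}"
    have "\<rho> (act js x) \<le> \<rho> x + \<epsilon> * \<delta> * real N * real F - r * real (len (act js))" for js
    proof -
      obtain ks where ks: "act ks = act js" "length ks = len (act js)" using reduced_word .
      then have red: "reduced ks" by (simp add: reduced_def)
      define n where "n = length ks"
      define \<theta> where "\<theta> k y = \<alpha> (ks ! k) (act (drop (Suc k) ks) y)" for k y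
      have "\<exists>c :: 'i \<Rightarrow> nat. \<forall>y. \<theta> k y = (\<Sum>i\<in>UNIV. real (c i) * \<alpha> i y)" if "k < n" for k
      proof -
        have "ks = take k ks @ ks ! k # drop (Suc k) ks"
          using that by (simp add: n_def id_take_nth_drop)
        then have "reduced (ks ! k # drop (Suc k) ks)" using red reduced_append(2) by metis
        then show ?thesis
          using positive_root_reduced unfolding positive_root_def \<theta>_def by blast
      qed
      then obtain c :: "nat \<Rightarrow> 'i \<Rightarrow> nat"
        where c: "\<And>k y. k < n \<Longrightarrow> \<theta> k y = (\<Sum>i\<in>UNIV. real (c k i) * \<alpha> i y)" by metis
      have "inj_on c {..<n}"
      proof (rule linorder_inj_onI')
        fix k l assume "k \<in> {..<n}" "l \<in> {..<n}" "k < l"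
        then show "c k \<noteq> c l"
          using inversion_roots_distinct[OF red, of k l x] c[of k] c[of l] x
          by (auto simp: n_def \<theta>_def)
      qed
      then have "real N * (real n - real F) \<le> real (\<Sum>k<n. sum (c k) UNIV)"
        unfolding F_def by (rule sum_weights_ge)
      then have "\<epsilon> * \<delta> * (real N * (real n - real F)) \<le> \<epsilon> * \<delta> * real (\<Sum>k<n. sum (c k) UNIV)"
        using \<epsilon> \<delta> by (intro mult_left_mono) auto
      also have "\<dots> = (\<Sum>k<n. \<epsilon> * (\<Sum>i\<in>UNIV. real (c k i) * \<delta>))"
        by (simp add: sum_distrib_left sum_distrib_right mult_ac)
      also have "\<dots> \<le> (\<Sum>k<n. \<rho> (\<alpha>c (ks ! k)) * \<theta> k x)"
      proof (rule sum_mono)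
        fix k assume "k \<in> {..<n}"
        then have "(\<Sum>i\<in>UNIV. real (c k i) * \<delta>) \<le> \<theta> k x"
          using c \<delta> by (auto intro!: sum_mono mult_left_mono)
        moreover have "0 \<le> (\<Sum>i\<in>UNIV. real (c k i) * \<delta>)" using \<delta> by (intro sum_nonneg) auto
        ultimately show "\<epsilon> * (\<Sum>i\<in>UNIV. real (c k i) * \<delta>) \<le> \<rho> (\<alpha>c (ks ! k)) * \<theta> k x"
          using \<epsilon> by (intro mult_mono) (auto intro: order_trans less_imp_le)
      qed
      also have "\<dots> = \<rho> x - \<rho> (act ks x)"
        by (simp add: functional_act_expansion[of \<rho> ks] n_def \<theta>_def)
      finally have "\<rho> (act ks x) \<le> \<rho> x + \<epsilon> * \<delta> * real N * real F - \<epsilon> * \<delta> * real N * real n"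
        by (simp add: algebra_simps)
      moreover have "r * real n \<le> \<epsilon> * \<delta> * real N * real n" using N by (intro mult_right_mono) auto
      ultimately show ?thesis using ks by (simp add: n_def)
    qed
    then show ?thesis unfolding decay_set_def by blast
  qed
  then show "x \<in> decay_domain \<rho>" by (simp add: decay_domain_def)
qed

text \<open>Composition with \<open>act us\<close> changes lengths by at most
  \<open>length us\<close>, which only enlarges the constant.\<close>

lemma decay_domain_act:
  assumes "x \<in> decay_domain \<rho>"
  shows "act us x \<in> decay_domain \<rho>"
  unfolding decay_domain_def
proof (intro CollectI allI impI)
  fix r :: real assume r: "r \<ge> 0"
  then obtain C where C: "\<And>js. \<rho> (act js x) \<le> C - r * real (len (act js))"
    using assms by (auto simp: decay_domain_def decay_set_def)
  have "\<rho> (act js (act us x)) \<le> C + r * real (length us) - r * real (len (act js))" for js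
  proof -
    have "act js = act ((js @ us) @ rev us)" by (simp add: fun_eq_iff)
    then have "len (act js) = len (act (rev ((js @ us) @ rev us)))" using len_act_rev by metis
    also have "\<dots> \<le> length us + len (act (js @ us))"
      using len_act_append_le[of us "rev (js @ us)"] len_act_rev[of "js @ us"] by simp
    finally have "r * real (len (act js)) \<le> r * (real (length us) + real (len (act (js @ us))))"
      using r by (intro mult_left_mono) auto
    then show ?thesis using C[of "js @ us"] by (simp add: algebra_simps)
  qed
  then show "\<exists>C. act us x \<in> decay_set \<rho> r C" unfolding decay_set_def by blast
qed

lemma convex_decay_set: "convex (decay_set \<rho> r C)"
proof -
  have "decay_set \<rho> r C = (\<Inter>js. (\<lambda>x. \<rho> (act js x)) -` {..C - r * real (len (act js))})"
    by (auto simp: decay_set_def)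
  moreover have "linear (\<lambda>x. \<rho> (act js x))" for js
    using linear_compose[OF linear_act bounded_linear.linear[OF blinfun.bounded_linear_right]]
    by (simp add: o_def)
  ultimately show ?thesis
    by (simp add: convex_INT convex_linear_vimage)
qed

lemma convex_decay_domain: "convex (decay_domain \<rho>)"
proof (rule convexI)
  fix x y and u v :: real
  assume xy: "x \<in> decay_domain \<rho>" "y \<in> decay_domain \<rho>" and uv: "0 \<le> u" "0 \<le> v" "u + v = 1"
  show "u *\<^sub>R x + v *\<^sub>R y \<in> decay_domain \<rho>"
    unfolding decay_domain_def
  proof (intro CollectI allI impI)
    fix r :: real assume "r \<ge> 0"
    then obtain C D where "x \<in> decay_set \<rho> r C" "y \<in> decay_set \<rho> r D"
      using xy unfolding decay_domain_def by blast
    then have "x \<in> decay_set \<rho> r (max C D)" "y \<in> decay_set \<rho> r (max C D)"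
      using decay_set_mono[of C "max C D"] decay_set_mono[of D "max C D"] by (auto simp: subset_iff)
    then show "\<exists>C. u *\<^sub>R x + v *\<^sub>R y \<in> decay_set \<rho> r C"
      using convexD[OF convex_decay_set _ _ uv] by blast
  qed
qed

text \<open>Points on the walls are reached only as limits of points with decay, so the cone is
  first placed in the closure; convexity removes the closure once interiors are taken.\<close>

lemma interior_tits_cone_subset:
  assumes "\<rho> \<in> dual_chamber \<alpha>c"
  shows "interior (tits_cone \<alpha> \<alpha>c) \<subseteq> decay_domain \<rho>"
proof -
  have "tits_cone \<alpha> \<alpha>c \<subseteq> closure (decay_domain \<rho>)"
  proof
    fix z assume "z \<in> tits_cone \<alpha> \<alpha>c"
    then obtain us where z: "z \<in> act us ` closure (fundamental_chamber \<alpha>)"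
      using weyl_group_subset unfolding tits_cone_def by blast
    have "act us ` closure (fundamental_chamber \<alpha>) \<subseteq> closure (act us ` fundamental_chamber \<alpha>)"
      by (rule closure_linear_image_subset[OF linear_act])
    also have "\<dots> \<subseteq> closure (decay_domain \<rho>)"
      using chamber_subset_decay_domain[OF assms] decay_domain_act
      by (intro closure_mono) blast
    finally show "z \<in> closure (decay_domain \<rho>)" using z by blast
  qed
  then have "interior (tits_cone \<alpha> \<alpha>c) \<subseteq> interior (closure (decay_domain \<rho>))"
    by (rule interior_mono)
  then show ?thesis
    using convex_interior_closure[OF convex_decay_domain] interior_subset by blast
qed

section \<open>Uniform decay on polytopes and compact sets\<close>

lemma decay_uniform_on_polytope:
  assumes "finite V" "V \<subseteq> decay_domain \<rho>" "r \<ge> 0"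
  shows "\<exists>C. convex hull V \<subseteq> decay_set \<rho> r C"
proof -
  have "\<forall>v\<in>V. \<exists>C. v \<in> decay_set \<rho> r C" using assms unfolding decay_domain_def by blast
  then obtain C where C: "\<And>v. v \<in> V \<Longrightarrow> v \<in> decay_set \<rho> r (C v)"
    using bchoice[of V "\<lambda>v C. v \<in> decay_set \<rho> r C"] by blast
  have "V \<subseteq> decay_set \<rho> r (Max (C ` V))"
  proof
    fix v assume "v \<in> V"
    then show "v \<in> decay_set \<rho> r (Max (C ` V))"
      using C decay_set_mono[of "C v" "Max (C ` V)"] assms(1) by auto
  qed
  then show ?thesis using convex_decay_set hull_minimal by metis
qed

text \<open>Constants exist at first only pointwise. A box around each point, chosen inside
  \<open>U\<close>, is the hull of finitely many vertices and so has one constant; finitely many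
  boxes cover \<open>K\<close>.\<close>

lemma decay_uniform_on_compact:
  assumes "compact K" "open U" "K \<subseteq> U" "U \<subseteq> decay_domain \<rho>" "r \<ge> 0"
  shows "\<exists>C. K \<subseteq> decay_set \<rho> r C"
proof -
  have "\<exists>B C. open B \<and> x \<in> B \<and> B \<subseteq> decay_set \<rho> r C" if "x \<in> K" for x
  proof -
    have "x \<in> U" using that assms by blast
    then obtain a b where ab: "cbox a b \<subseteq> U" "x \<in> box a b"
      using open_contains_cbox[OF assms(2)] by metis
    obtain V where V: "finite V" "cbox a b = convex hull V"
      using closed_interval_as_convex_hull by metis
    have "V \<subseteq> decay_domain \<rho>" using ab V hull_subset[of V convex] assms by blast
    then obtain C where "convex hull V \<subseteq> decay_set \<rho> r C"
      using decay_uniform_on_polytope[OF V(1) _ assms(5)] by blast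
    then have "box a b \<subseteq> decay_set \<rho> r C" using V box_subset_cbox by blast
    then show ?thesis using ab open_box by blast
  qed
  then obtain B C where BC: "\<And>x. x \<in> K \<Longrightarrow> open (B x) \<and> x \<in> B x \<and> B x \<subseteq> decay_set \<rho> r (C x)"
    by metis
  have "K \<subseteq> (\<Union>x\<in>K. B x)" using BC by blast
  then obtain K' where K': "K' \<subseteq> K" "finite K'" "K \<subseteq> (\<Union>x\<in>K'. B x)"
    using compactE_image[OF assms(1), of K B] BC by metis
  have "K \<subseteq> decay_set \<rho> r (Max (C ` K'))"
  proof
    fix y assume "y \<in> K"
    then obtain x where x: "x \<in> K'" "y \<in> B x" using K' by blast
    then have "y \<in> decay_set \<rho> r (C x)" using BC K' by blast
    then show "y \<in> decay_set \<rho> r (Max (C ` K'))"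
      using decay_set_mono[of "C x" "Max (C ` K')"] x K' by auto
  qed
  then show ?thesis by blast
qed

text \<open>Reduced words show that at most \<open>CARD('i) ^ n\<close> elements have length
  \<open>n\<close>, so every finite partial sum is bounded by the series of powers of 1/2.\<close>

lemma summable_on_geometric_length:
  "(\<lambda>w. (1 / (2 * real CARD('i))) ^ len w) summable_on weyl_group \<alpha> \<alpha>c"
proof (rule nonneg_bdd_above_summable_on)
  let ?q = "1 / (2 * real CARD('i))"
  have "(\<Sum>w\<in>F. ?q ^ len w) \<le> 2" if F: "F \<subseteq> weyl_group \<alpha> \<alpha>c" "finite F" for F
  proof -
    have count: "card {w \<in> F. len w = n} \<le> CARD('i) ^ n" for n
    proof -
      have "{w \<in> F. len w = n} \<subseteq> act ` {js. set js \<subseteq> UNIV \<and> length js = n}"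
      proof
        fix w assume "w \<in> {w \<in> F. len w = n}"
        moreover from this obtain js where "w = act js" using F weyl_group_subset by blast
        ultimately show "w \<in> act ` {js. set js \<subseteq> UNIV \<and> length js = n}"
          using reduced_word[of js] by (metis (mono_tags, lifting) imageI mem_Collect_eq subset_UNIV)
      qed
      then have "card {w \<in> F. len w = n} \<le> card (act ` {js. set js \<subseteq> UNIV \<and> length js = n})"
        using finite_lists_length_eq[of "UNIV :: 'i set" n] by (intro card_mono) auto
      also have "\<dots> \<le> card {js :: 'i list. set js \<subseteq> UNIV \<and> length js = n}"
        using finite_lists_length_eq[of "UNIV :: 'i set" n] by (intro card_image_le) auto
      also have "\<dots> = CARD('i) ^ n" using card_lists_length_eq[of "UNIV :: 'i set" n] by simp
      finally show ?thesis .
    qed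
    have "(\<Sum>w\<in>F. ?q ^ len w) = (\<Sum>n\<in>len ` F. \<Sum>w\<in>{w \<in> F. len w = n}. ?q ^ len w)"
      using F by (intro sum.image_gen)
    also have "\<dots> = (\<Sum>n\<in>len ` F. real (card {w \<in> F. len w = n}) * ?q ^ n)"
      by (intro sum.cong) auto
    also have "\<dots> \<le> (\<Sum>n\<in>len ` F. (1 / 2) ^ n)"
    proof (rule sum_mono)
      fix n
      have "real (card {w \<in> F. len w = n}) * ?q ^ n \<le> real (CARD('i) ^ n) * ?q ^ n"
        using count by (intro mult_right_mono) (auto simp del: of_nat_power)
      also have "\<dots> = (real CARD('i) * ?q) ^ n" by (simp only: power_mult_distrib of_nat_power)
      finally show "real (card {w \<in> F. len w = n}) * ?q ^ n \<le> (1 / 2) ^ n" by simp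
    qed
    also have "\<dots> \<le> (\<Sum>n. (1 / 2) ^ n)"
      using F by (intro sum_le_suminf) (auto intro: summable_geometric)
    also have "\<dots> = 2" by (subst suminf_geometric) auto
    finally show ?thesis .
  qed
  then show "bdd_above (sum (\<lambda>w. ?q ^ len w) ` {F. F \<subseteq> weyl_group \<alpha> \<alpha>c \<and> finite F})"
    by (intro bdd_aboveI[of _ 2]) auto
qed simp

end

section \<open>Convergence of the series\<close>

theorem theorem3p5:
  fixes A :: "int^'i^'i::finite"
    and \<alpha> :: "'i \<Rightarrow> 'h::euclidean_space \<Rightarrow>\<^sub>L real"
    and \<alpha>c :: "'i \<Rightarrow> 'h"
    and Ap :: "('g::topological_space, 'b) monoid_scheme"
    and ex :: "'h \<Rightarrow> 'g"
    and lam :: "'h \<Rightarrow>\<^sub>L complex"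
    and M :: real
    and K :: "'g set"
  assumes "generalized_cartan_matrix A"
    and "symmetrizable A"
    and "det A \<noteq> 0"
    and "realization A \<alpha> \<alpha>c"
    and "exp_group ex Ap"
    and "Re_dual lam \<in> dual_chamber \<alpha>c"
    and "M > 0"
    and "compact K"
    and "K \<subseteq> ex ` interior (tits_cone \<alpha> \<alpha>c)"
  shows "(\<forall>a\<in>K. (\<lambda>w. norm (weyl_series_term \<alpha> \<alpha>c ex lam M w a)) summable_on weyl_group \<alpha> \<alpha>c) \<and>
         uniform_limit K (\<lambda>F a. \<Sum>w\<in>F. weyl_series_term \<alpha> \<alpha>c ex lam M w a)
           (\<lambda>a. \<Sum>\<^sub>\<infinity>w\<in>weyl_group \<alpha> \<alpha>c. weyl_series_term \<alpha> \<alpha>c ex lam M w a)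
           (finite_subsets_at_top (weyl_group \<alpha> \<alpha>c))"
proof -
  interpret cartan_pairing A \<alpha> \<alpha>c
    using assms(1,4) by unfold_locales (auto simp: realization_def)
  let ?W = "weyl_group \<alpha> \<alpha>c" and ?f = "weyl_series_term \<alpha> \<alpha>c ex lam M"
  let ?L = "inv_into UNIV ex" and ?\<rho> = "Re_dual lam" and ?U = "interior (tits_cone \<alpha> \<alpha>c)"
  define q where "q = 1 / (2 * real CARD('i))"
  have q: "q > 0" by (simp add: q_def)
  \<comment> \<open>This rate gives \<open>M * exp (- r) \<le> q\<close>, the ratio of the geometric
    majorant. The maximum with 0 meets the condition \<open>r \<ge> 0\<close> of the decay
    estimates.\<close>
  define r where "r = max 0 (ln (M / q))"
  have "exp (ln (M / q)) \<le> exp r" by (simp add: r_def)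
  then have "M / q \<le> exp r" using assms(7) q by simp
  then have Mr: "M * exp (- r) \<le> q" using q by (simp add: exp_minus field_simps)
  have hom: "homeomorphism UNIV (carrier Ap) ex ?L" using assms(5) by (simp add: exp_group_def)
  have L_ex: "?L (ex x) = x" for x using hom by (simp add: homeomorphism_def)
  have "K \<subseteq> carrier Ap" using hom assms(9) unfolding homeomorphism_def by blast
  then have "continuous_on K ?L"
    using hom continuous_on_subset unfolding homeomorphism_def by blast
  then have "compact (?L ` K)" using assms(8) by (rule compact_continuous_image)
  moreover have "?L ` K \<subseteq> ?U" using assms(9) L_ex by force
  ultimately obtain C where C: "?L ` K \<subseteq> decay_set ?\<rho> r C"
    using decay_uniform_on_compact[of "?L ` K" ?U ?\<rho> r] interior_tits_cone_subset[OF assms(6)]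
    by (auto simp: r_def)
  have bound: "norm (?f w a) \<le> exp C * q ^ len w" if w: "w \<in> ?W" and a: "a \<in> K" for w a
  proof -
    obtain js where js: "w = act js" using w weyl_group_subset by blast
    \<comment> \<open>The dual action evaluates \<open>lam\<close> at the inverse of
      \<open>w\<close>, which is \<open>act (rev js)\<close> and has the same length as
      \<open>w\<close>.\<close>
    have "norm (?f w a) = M ^ len w * exp (?\<rho> (act (rev js) (?L a)))"
      using assms(7) dual_action_apply[OF assms(1,4) w, of lam "?L a"]
      by (simp add: weyl_series_term_def torus_power_def norm_mult norm_power Re_dual_apply
          flip: inv_act js)
    also have "\<dots> \<le> M ^ len w * exp (C - r * real (len w))"
    proof -
      have "?\<rho> (act (rev js) (?L a)) \<le> C - r * real (len (act (rev js)))"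
        using C a unfolding decay_set_def by blast
      then show ?thesis using assms(7) by (simp add: js len_act_rev)
    qed
    also have "\<dots> = exp C * (M * exp (- r)) ^ len w"
      by (simp add: power_mult_distrib exp_diff exp_minus exp_of_nat2_mult field_simps)
    also have "\<dots> \<le> exp C * q ^ len w"
      using Mr assms(7) by (intro mult_left_mono power_mono) auto
    finally show ?thesis .
  qed
  have summable: "(\<lambda>w. exp C * q ^ len w) summable_on ?W"
    unfolding q_def by (intro summable_on_cmult_right summable_on_geometric_length)
  have "(\<lambda>w. norm (?f w a)) summable_on ?W" if "a \<in> K" for a
    using bound[OF _ that] by (intro summable_on_comparison_test[OF summable]) auto
  moreover have "uniform_limit K (\<lambda>F a. \<Sum>w\<in>F. ?f w a) (\<lambda>a. \<Sum>\<^sub>\<infinity>w\<in>?W. ?f w a)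
      (finite_subsets_at_top ?W)"
    using bound summable by (rule Weierstrass_m_test_general)
  ultimately show ?thesis by blast
qed

end
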